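(* Let $(\mathcal{P},\circ,[\cdot,\cdot])$ be a finite-dimensional transposed Poisson algebra over an algebraically closed field $\mathbb{F}$ of characteristic different from two. Then there exist ideals $\mathcal{D},\mathcal{N}$ of $\mathcal{P}$ such that $\mathcal{P}=\mathcal{D}\oplus\mathcal{N}$, the associative algebra $(\mathcal{D},\circ)$ is unital, and the associative algebra $(\mathcal{N},\circ)$ is nilpotent. Moreover, $\mathcal{D}$ can be decomposed as $\mathcal{D}=\bigoplus_{i\in\Delta}\mathcal{D}_i$, where each $\mathcal{D}_i$ is an ideal and, for every $x\in\mathcal{D}_i$, the restriction $P_x|_{\mathcal{D}_i}$ has a unique eigenvalue.
   Context: A transposed Poisson algebra over a field $\mathbb{F}$ of characteristic $\neq 2$ is a vector space $\mathcal{P}$ with an associative commutative multiplication $\circ$ (not assumed unital) and a Lie bracket $[\cdot,\cdot]$ satisfying $2x\circ[y,z]=[x\circ y,z]+[y,x\circ z]$ for all $x,y,z\in\mathcal{P}$. An ideal of $\mathcal{P}$ is a subspace that is an ideal for both multiplications simultaneously. The symbol $\oplus$ denotes direct sum of transposed Poisson algebras (direct sum of ideals). For $x\in\mathcal{P}$, $P_x\in\mathrm{End}(\mathcal{P})$ is the map $P_x(y)=x\circ y$. The zero algebra is allowed as $\mathcal{D}$ or $\mathcal{N}$ (it counts as both unital and nilpotent, with $\Delta$ empty when $\mathcal{D}=0$). *)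

theory Defs
  imports "HOL-Computational_Algebra.Computational_Algebra"
begin

text \<open>
  The underlying space is the whole type \<open>'b\<close>, with the scalar multiplication as a parameter.
  The associative product is not assumed to have a unit.
\<close>

locale transposed_poisson_algebra = vector_space scale
  for scale :: "'a::field \<Rightarrow> 'b::ab_group_add \<Rightarrow> 'b" +
  fixes circ :: "'b \<Rightarrow> 'b \<Rightarrow> 'b"
    and bracket :: "'b \<Rightarrow> 'b \<Rightarrow> 'b"
  assumes char_neq_2: "CHAR('a) \<noteq> 2"
    and linear_circ_left: "Vector_Spaces.linear scale scale (\<lambda>x. circ x y)"
    and linear_circ_right: "Vector_Spaces.linear scale scale (\<lambda>y. circ x y)"
    and circ_assoc: "circ (circ x y) z = circ x (circ y z)"
    and circ_commute: "circ x y = circ y x"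
    and linear_bracket_left: "Vector_Spaces.linear scale scale (\<lambda>x. bracket x y)"
    and linear_bracket_right: "Vector_Spaces.linear scale scale (\<lambda>y. bracket x y)"
    and bracket_self: "bracket x x = 0"
    and jacobi: "bracket x (bracket y z) + bracket y (bracket z x) + bracket z (bracket x y) = 0"
    and transposed_leibniz:
      "scale 2 (circ x (bracket y z)) = bracket (circ x y) z + bracket y (circ x z)"

text \<open>
  Since the associative product is commutative and the bracket is antisymmetric, one-sided
  closure suffices.
\<close>

definition tp_ideal ::
  "('a::field \<Rightarrow> 'b::ab_group_add \<Rightarrow> 'b) \<Rightarrow> ('b \<Rightarrow> 'b \<Rightarrow> 'b) \<Rightarrow> ('b \<Rightarrow> 'b \<Rightarrow> 'b) \<Rightarrow> 'b set \<Rightarrow> bool" where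
  "tp_ideal scale circ bracket I \<longleftrightarrow>
     module.subspace scale I \<and> (\<forall>x. \<forall>y\<in>I. circ x y \<in> I \<and> bracket x y \<in> I)"

text \<open>
  Internal direct sums of subspaces. When the summands are ideals, both operations are
  automatically componentwise, because a product or bracket of elements of two different
  summands lies in their intersection.
\<close>

definition direct_sum2 :: "'b::ab_group_add set \<Rightarrow> 'b set \<Rightarrow> 'b set \<Rightarrow> bool" where
  "direct_sum2 V A B \<longleftrightarrow> V = {a + b | a b. a \<in> A \<and> b \<in> B} \<and> A \<inter> B = {0}"

definition direct_sum_family ::
  "('a::field \<Rightarrow> 'b::ab_group_add \<Rightarrow> 'b) \<Rightarrow> 'b set \<Rightarrow> 'i set \<Rightarrow> ('i \<Rightarrow> 'b set) \<Rightarrow> bool" where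
  "direct_sum_family scale V I A \<longleftrightarrow>
     V = module.span scale (\<Union>i\<in>I. A i) \<and>
     (\<forall>i\<in>I. A i \<inter> module.span scale (\<Union>j\<in>I - {i}. A j) = {0})"

definition unital_on :: "('b \<Rightarrow> 'b \<Rightarrow> 'b) \<Rightarrow> 'b set \<Rightarrow> bool" where
  "unital_on circ A \<longleftrightarrow> (\<exists>e\<in>A. \<forall>x\<in>A. circ e x = x \<and> circ x e = x)"

text \<open>The index is shifted: \<open>alg_power scale circ A k\<close> is the power \<open>A\<^sup>k\<^sup>+\<^sup>1\<close>.\<close>

primrec alg_power ::
  "('a::field \<Rightarrow> 'b::ab_group_add \<Rightarrow> 'b) \<Rightarrow> ('b \<Rightarrow> 'b \<Rightarrow> 'b) \<Rightarrow> 'b set \<Rightarrow> nat \<Rightarrow> 'b set" where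
  "alg_power scale circ A 0 = A"
| "alg_power scale circ A (Suc k) =
     module.span scale {circ x y | x y. x \<in> A \<and> y \<in> alg_power scale circ A k}"

definition nilpotent_on ::
  "('a::field \<Rightarrow> 'b::ab_group_add \<Rightarrow> 'b) \<Rightarrow> ('b \<Rightarrow> 'b \<Rightarrow> 'b) \<Rightarrow> 'b set \<Rightarrow> bool" where
  "nilpotent_on scale circ A \<longleftrightarrow> (\<exists>k. alg_power scale circ A k = {0})"

definition eigenvalue_on ::
  "('a::field \<Rightarrow> 'b::ab_group_add \<Rightarrow> 'b) \<Rightarrow> ('b \<Rightarrow> 'b) \<Rightarrow> 'b set \<Rightarrow> 'a \<Rightarrow> bool" where
  "eigenvalue_on scale f S c \<longleftrightarrow> (\<exists>v\<in>S. v \<noteq> 0 \<and> f v = scale c v)"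

end

theory Submission
  imports Defs
begin

text \<open>
  For an idempotent \<open>e\<close> the Peirce components \<open>{v. e \<circ> v = v}\<close> and \<open>{v. e \<circ> v = 0}\<close> are ideals
  also for the bracket. Take a set of nonzero orthogonal idempotents of maximal cardinality and
  let \<open>e\<close> be its sum. By maximality the annihilator of \<open>e\<close> contains no nonzero idempotent, hence
  is nil by the Fitting decomposition, hence nilpotent; and each member \<open>f\<close> is primitive, so that
  any \<open>x - c f\<close> in the component of \<open>f\<close> acts on it either invertibly or nilpotently.
\<close>

section \<open>Finite-dimensional commutative associative algebras\<close>

locale fin_dim_comm_algebra = finite_dimensional_vector_space scale Basis
  for scale :: "'a::field \<Rightarrow> 'b::ab_group_add \<Rightarrow> 'b" and Basis +
  fixes circ :: "'b \<Rightarrow> 'b \<Rightarrow> 'b"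
  assumes circ_linear: "Vector_Spaces.linear scale scale (circ x)"
    and circ_assoc: "circ (circ x y) z = circ x (circ y z)"
    and circ_commute: "circ x y = circ y x"
begin

lemma circ_left_commute: "circ x (circ y z) = circ y (circ x z)"
  by (metis circ_assoc circ_commute)

lemmas circ_ac = circ_assoc circ_commute circ_left_commute

lemma module_hom_circ: "module_hom scale scale (circ x)"
  using circ_linear[of x] by (simp add: linear_iff_module_hom)

lemmas circ_add_right = module_hom.add[OF module_hom_circ]
  and circ_diff_right = module_hom.diff[OF module_hom_circ]
  and circ_scale_right = module_hom.scale[OF module_hom_circ]
  and circ_zero_right = module_hom.zero[OF module_hom_circ]
  and circ_sum_right = module_hom.sum[OF module_hom_circ]

lemma circ_diff_left: "circ (x - y) z = circ x z - circ y z"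
  and circ_scale_left: "circ (scale c x) z = scale c (circ x z)"
  and circ_zero_left: "circ 0 z = 0"
  and circ_sum_left: "circ (sum g S) z = (\<Sum>a\<in>S. circ (g a) z)"
  by (simp_all add: circ_commute[of _ z] circ_add_right circ_diff_right circ_scale_right
      circ_zero_right circ_sum_right)

lemma subspace_circ_image: "subspace S \<Longrightarrow> subspace (circ x ` S)"
  by (rule module_hom.subspace_image[OF module_hom_circ])

lemma subspace_circ_vimage: "subspace S \<Longrightarrow> subspace {v. circ x v \<in> S}"
  by (auto simp: subspace_def circ_zero_right circ_add_right circ_scale_right)

lemma subspace_fixed: "subspace {v. circ x v = v}"
  by (auto simp: subspace_def circ_zero_right circ_add_right circ_scale_right)

lemma subspace_annihilator: "subspace {v. circ x v = 0}"
  by (auto simp: subspace_def circ_zero_right circ_add_right circ_scale_right)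

lemma circ_funpow_diff: "(circ x ^^ n) (y - z) = (circ x ^^ n) y - (circ x ^^ n) z"
  by (induction n) (simp_all add: circ_diff_right)

text \<open>Without a unit, the power x^(n+1) has to be written \<open>(circ x ^^ n) x\<close>; this
  identity lets multiplication by such a power be traded for the operator
  \<open>circ x ^^ Suc n\<close>.\<close>

lemma funpow_circ_left: "circ ((circ x ^^ n) y) z = (circ x ^^ n) (circ y z)"
  by (induction n) (simp_all add: circ_assoc)

lemma funpow_closed: "\<lbrakk>\<And>y. y \<in> A \<Longrightarrow> circ x y \<in> A; y \<in> A\<rbrakk> \<Longrightarrow> (circ x ^^ n) y \<in> A"
  by (induction n) auto

lemma subspace_funpow_image: "subspace S \<Longrightarrow> subspace ((circ x ^^ n) ` S)"
proof (induction n)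
  case (Suc n)
  then show ?case
    using subspace_circ_image[of "(circ x ^^ n) ` S" x] by (simp add: image_comp)
qed simp

section \<open>Descending chains, Fitting idempotents and nil algebras\<close>

lemma decreasing_subspaces_stabilize:
  fixes S :: "nat \<Rightarrow> 'b set"
  assumes "\<And>n. subspace (S n)" and "\<And>n. S (Suc n) \<subseteq> S n"
  shows "\<exists>n. S (Suc n) = S n"
proof -
  \<comment> \<open>A term of least dimension cannot properly contain its successor.\<close>
  obtain n where "\<And>m. dim (S n) \<le> dim (S m)"
    using ex_has_least_nat[of "\<lambda>_. True" _ "\<lambda>n. dim (S n)"] by auto
  then show ?thesis
    using subspace_dim_equal[of "S (Suc n)" "S n"] assms by blast
qed

text \<open>
  Fitting decomposition: the eventual image \<open>x\<^sup>n A\<close> is a subalgebra on which \<open>x\<close> acts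
  bijectively, so it has a unit \<open>e\<close>.
\<close>
lemma fitting_idempotent:
  assumes A: "subspace A" "\<And>y z. \<lbrakk>y \<in> A; z \<in> A\<rbrakk> \<Longrightarrow> circ y z \<in> A" and x: "x \<in> A"
  obtains e w n where "e \<in> A" "circ e e = e" "w \<in> A" "e = circ x w"
    "circ e ((circ x ^^ n) x) = (circ x ^^ n) x"
proof -
  define S where "S n = (circ x ^^ n) ` A" for n
  have closed: "circ x y \<in> A" if "y \<in> A" for y using A(2) x that by blast
  have dec: "S (Suc n) \<subseteq> S n" for n
    unfolding S_def using closed by (auto simp: funpow_swap1)
  obtain n where n: "S (Suc n) = S n"
    using decreasing_subspaces_stabilize[of S] dec subspace_funpow_image[OF A(1)]
    unfolding S_def by blast
  \<comment> \<open>A single equality propagates, because \<open>S (Suc m)\<close> is the image of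
    \<open>S m\<close> under \<open>circ x\<close>.\<close>
  have stab: "S (n + k) = S n" for k
  proof (induction k)
    case (Suc k)
    have "S (n + Suc k) = circ x ` S (n + k)" by (simp add: S_def image_comp)
    also have "\<dots> = S (Suc n)" using Suc by (simp add: S_def image_comp)
    finally show ?case using n by simp
  qed simp
  \<comment> \<open>This is x^(n+1), an element of \<open>S n\<close> that will turn out to multiply
    \<open>S n\<close> onto itself.\<close>
  define z where "z = (circ x ^^ n) x"
  have S_A: "S m \<subseteq> A" for m using funpow_closed[of A x] closed by (auto simp: S_def)
  have zS: "z \<in> S n" using x by (auto simp: z_def S_def)
  have zc: "circ z y = (circ x ^^ Suc n) y" for y
    by (simp add: z_def funpow_circ_left funpow_swap1)
  have surj: "\<exists>w\<in>S n. circ z w = v" if "v \<in> S n" for v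
  proof -
    have "v \<in> S (Suc n + n)" using that stab[of "Suc n"] by (simp add: add.commute)
    then obtain a where "a \<in> A" "v = (circ x ^^ (Suc n + n)) a"
      unfolding S_def by blast
    then have "(circ x ^^ n) a \<in> S n" "circ z ((circ x ^^ n) a) = v"
      unfolding zc S_def by (auto simp: funpow_add)
    then show ?thesis by blast
  qed
  \<comment> \<open>Solving z e = z produces a unit of \<open>S n\<close>: every v there has the
    form z w, so e v = e z w = z w = v.\<close>
  obtain e where e: "e \<in> S n" "circ z e = z" using surj zS by blast
  have unit: "circ e v = v" if "v \<in> S n" for v
    using surj[OF that] e(2) by (metis circ_ac)
  \<comment> \<open>Membership one step deeper in the chain exhibits \<open>e\<close> as a multiple
    of \<open>x\<close> with cofactor in \<open>A\<close>.\<close>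
  have "e \<in> S (Suc n)" using n e(1) by blast
  then obtain a where a: "a \<in> A" "e = circ x ((circ x ^^ n) a)" by (auto simp: S_def)
  show ?thesis
    by (rule that[of e "(circ x ^^ n) a" n])
      (use a e(1) unit zS S_A z_def funpow_closed[of A x] closed in auto)
qed

text \<open>A Nakayama argument that discards the generators one at a time. Modulo the span
  \<open>W\<close> of the products with the other generators, every element of \<open>B\<close> lies
  in x B, hence in x^n B for every n, which is zero for large n.\<close>

lemma nil_finite_generation_zero:
  assumes "finite X" and B: "subspace B" "\<And>x b. \<lbrakk>x \<in> X; b \<in> B\<rbrakk> \<Longrightarrow> circ x b \<in> B"
    and nil: "\<And>x. x \<in> X \<Longrightarrow> \<exists>n. \<forall>y. (circ x ^^ n) y = 0"
    and "B \<subseteq> span (\<Union>x\<in>X. circ x ` B)"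
  shows "B = {0}"
  using assms
proof (induction X)
  case empty
  then show ?case using subspace_0[of B] by auto
next
  case (insert x X)
  define W where "W = span (\<Union>y\<in>X. circ y ` B)"
  have W: "subspace W" by (simp add: W_def)
  \<comment> \<open>Multiplications by \<open>x\<close> and by the other generators commute, and
    \<open>x\<close> preserves \<open>B\<close>.\<close>
  have xW: "circ x w \<in> W" if "w \<in> W" for w
  proof -
    have "W \<subseteq> {v. circ x v \<in> W}" unfolding W_def
    proof (rule span_minimal)
      show "subspace {v. circ x v \<in> span (\<Union>y\<in>X. circ y ` B)}"
        by (rule subspace_circ_vimage) simp
      show "(\<Union>y\<in>X. circ y ` B) \<subseteq> {v. circ x v \<in> span (\<Union>y\<in>X. circ y ` B)}"
        using insert.prems(2) by (fastforce simp: circ_left_commute[of x] intro!: span_base)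
    qed
    then show ?thesis using that by auto
  qed
  have step: "\<exists>b'\<in>B. b - circ x b' \<in> W" if "b \<in> B" for b
  proof -
    have "b \<in> span (circ x ` B \<union> (\<Union>y\<in>X. circ y ` B))" using insert.prems(4) that by auto
    then obtain u w where "u \<in> span (circ x ` B)" "w \<in> W" "b = u + w"
      unfolding span_Un W_def by auto
    moreover have "span (circ x ` B) = circ x ` B"
      using insert.prems(1) subspace_circ_image by (simp add: span_eq_iff)
    ultimately obtain b' where "b' \<in> B" "b - circ x b' = w" by auto
    then show ?thesis using \<open>w \<in> W\<close> by auto
  qed
  have iter: "\<exists>b'\<in>B. b - (circ x ^^ n) b' \<in> W" if "b \<in> B" for b n
  proof (induction n)
    case 0
    show ?case using that subspace_0[OF W] by (intro bexI[of _ b]) auto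
  next
    case (Suc n)
    then obtain b' where b': "b' \<in> B" "b - (circ x ^^ n) b' \<in> W" by blast
    \<comment> \<open>Replacing b' by x b'' raises the exponent by one; the error stays in
      \<open>W\<close> by \<open>xW\<close>.\<close>
    obtain b'' where b'': "b'' \<in> B" "b' - circ x b'' \<in> W" using step b'(1) by blast
    have "(circ x ^^ n) (b' - circ x b'') \<in> W" using funpow_closed[of W x] xW b''(2) by blast
    from subspace_add[OF W b'(2) this] b''(1) show ?case
      by (intro bexI[of _ b'']) (auto simp: circ_funpow_diff funpow_swap1)
  qed
  obtain n where "\<And>y. (circ x ^^ n) y = 0" using insert.prems(3) by blast
  then have "B \<subseteq> W" using iter[of _ n] by auto
  then show ?case using insert.IH insert.prems unfolding W_def by blast
qed

lemma subspace_alg_power: "subspace A \<Longrightarrow> subspace (alg_power scale circ A k)"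
  by (cases k) simp_all

lemma alg_power_decreasing:
  assumes A: "subspace A" "\<And>y z. \<lbrakk>y \<in> A; z \<in> A\<rbrakk> \<Longrightarrow> circ y z \<in> A"
  shows "alg_power scale circ A (Suc k) \<subseteq> alg_power scale circ A k"
proof (induction k)
  case 0
  have "span {circ x y | x y. x \<in> A \<and> y \<in> A} \<subseteq> A"
    using A by (intro span_minimal) blast+
  then show ?case by simp
next
  case (Suc k)
  then show ?case
    unfolding alg_power.simps(2)[of _ _ _ "Suc k"] alg_power.simps(2)[of _ _ _ k]
    by (intro span_mono) blast
qed

text \<open>The descending powers stabilise at some \<open>B\<close> with B = A B. The elements of a
  finite basis \<open>X\<close> of \<open>A\<close> suffice as multipliers, so the Nakayama argument
  applies and gives B = 0.\<close>

lemma nil_imp_nilpotent_on: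
  assumes A: "subspace A" "\<And>y z. \<lbrakk>y \<in> A; z \<in> A\<rbrakk> \<Longrightarrow> circ y z \<in> A"
    and nil: "\<And>x. x \<in> A \<Longrightarrow> \<exists>n. \<forall>y. (circ x ^^ n) y = 0"
  shows "nilpotent_on scale circ A"
proof -
  obtain k where k: "alg_power scale circ A (Suc k) = alg_power scale circ A k"
    using decreasing_subspaces_stabilize[of "alg_power scale circ A",
        OF subspace_alg_power[OF A(1)] alg_power_decreasing[OF A]]
    by metis
  define B where "B = alg_power scale circ A k"
  have B: "B = span {circ x y | x y. x \<in> A \<and> y \<in> B}" "subspace B"
    using k subspace_alg_power[OF A(1)] by (simp_all add: B_def)
  obtain X where X: "X \<subseteq> A" "independent X" "A \<subseteq> span X" using basis_exists[of A] by metis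
  define W where "W = span (\<Union>x\<in>X. circ x ` B)"
  have "circ x y \<in> W" if "x \<in> A" "y \<in> B" for x y
  proof -
    have "circ y x' \<in> W" if "x' \<in> X" for x'
      unfolding W_def circ_commute[of y x'] using that \<open>y \<in> B\<close> by (auto intro: span_base)
    then have "span X \<subseteq> {x. circ y x \<in> W}"
      by (intro span_minimal subspace_circ_vimage) (auto simp: W_def)
    then show ?thesis using that X(3) circ_commute[of x y] by auto
  qed
  then have "B \<subseteq> W" by (subst B(1), intro span_minimal) (auto simp: W_def)
  moreover have "circ x b \<in> B" if "x \<in> X" "b \<in> B" for x b
    using that X(1) by (subst B(1)) (auto intro!: span_base)
  moreover have "\<exists>n. \<forall>y. (circ x ^^ n) y = 0" if "x \<in> X" for x
    using nil that X(1) by (meson subsetD)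
  ultimately have "B = {0}"
    using nil_finite_generation_zero[OF finiteI_independent[OF X(2)] B(2)] unfolding W_def by simp
  then show ?thesis unfolding nilpotent_on_def B_def by blast
qed

text \<open>The Fitting idempotent of each element is forced to vanish, so some power of the element
  is zero and the nil criterion applies.\<close>

lemma no_idempotent_imp_nilpotent_on:
  assumes A: "subspace A" "\<And>y z. \<lbrakk>y \<in> A; z \<in> A\<rbrakk> \<Longrightarrow> circ y z \<in> A"
    and "\<And>e. \<lbrakk>e \<in> A; circ e e = e\<rbrakk> \<Longrightarrow> e = 0"
  shows "nilpotent_on scale circ A"
proof (rule nil_imp_nilpotent_on[OF A])
  fix x assume "x \<in> A"
  then obtain e w n where "e \<in> A" "circ e e = e" "circ e ((circ x ^^ n) x) = (circ x ^^ n) x"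
    using fitting_idempotent[OF A] by metis
  then have "(circ x ^^ n) x = 0" using assms(3) circ_zero_left by metis
  then have "\<forall>y. (circ x ^^ Suc n) y = 0"
    using funpow_circ_left[of n x x] circ_zero_left by (simp add: funpow_swap1)
  then show "\<exists>n. \<forall>y. (circ x ^^ n) y = 0" by blast
qed

section \<open>Primitive and orthogonal idempotents\<close>

lemma fixed_imp_closed: "circ f x = x \<Longrightarrow> circ f (circ x y) = circ x y"
  by (metis circ_assoc)

text \<open>The element \<open>y\<close> = x - c f kills an eigenvector for c, so its Fitting
  idempotent cannot be \<open>f\<close> and must be 0. Hence \<open>y\<close> is nilpotent, while it
  acts on an eigenvector for d as the scalar d - c.\<close>

lemma primitive_idempotent_unique_eigenvalue:
  assumes f: "circ f f = f"
    and prim: "\<And>e. \<lbrakk>circ e e = e; circ f e = e\<rbrakk> \<Longrightarrow> e = 0 \<or> e = f"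
    and x: "circ f x = x"
    and c: "eigenvalue_on scale (circ x) {v. circ f v = v} c"
    and d: "eigenvalue_on scale (circ x) {v. circ f v = v} d"
  shows "d = c"
proof -
  define y where "y = x - scale c f"
  have y: "circ f y = y" by (simp add: y_def circ_diff_right circ_scale_right f x)
  obtain e w n where e: "circ f e = e" "circ e e = e" "e = circ y w"
    "circ e ((circ y ^^ n) y) = (circ y ^^ n) y"
    by (rule fitting_idempotent[of "{v. circ f v = v}" y])
      (use subspace_fixed fixed_imp_closed y in auto)
  have y_eigen: "circ y v = scale (a - c) v" if "circ f v = v" "circ x v = scale a v" for a v
    using that by (simp add: y_def circ_diff_left circ_scale_left scale_left_diff_distrib)
  obtain v where v: "circ f v = v" "v \<noteq> 0" "circ x v = scale c v"
    using c by (auto simp: eigenvalue_on_def)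
  have "circ y v = 0" using y_eigen v by simp
  \<comment> \<open>Being a multiple of \<open>y\<close>, the idempotent kills \<open>v\<close> too;
    e = f would then give v = f v = 0.\<close>
  then have "circ e v = 0" using e(3) circ_zero_right by (metis circ_ac)
  then have "e = 0" using prim e v by metis
  then have nil: "(circ y ^^ n) y = 0" using e(4) circ_zero_left by metis
  obtain u where u: "circ f u = u" "u \<noteq> 0" "circ x u = scale d u"
    using d by (auto simp: eigenvalue_on_def)
  have "(circ y ^^ m) u = scale ((d - c) ^ m) u" for m
    by (induction m) (use y_eigen u in \<open>simp_all add: circ_scale_right mult.commute\<close>)
  moreover have "(circ y ^^ Suc n) u = 0"
    using funpow_circ_left[of n y y u] nil circ_zero_left by (simp add: funpow_swap1)
  ultimately have "scale ((d - c) ^ Suc n) u = 0" by metis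
  then show ?thesis using u(2) by (auto simp: scale_eq_0_iff)
qed

text \<open>Excluding 0 makes every such set linearly independent, so that its cardinality is
  bounded by the dimension.\<close>

definition orthogonal_idempotents :: "'b set \<Rightarrow> bool" where
  "orthogonal_idempotents E \<longleftrightarrow> finite E \<and> 0 \<notin> E \<and>
     (\<forall>e\<in>E. \<forall>f\<in>E. circ e f = (if e = f then e else 0))"

text \<open>Multiplication by \<open>f\<close> isolates one coefficient. Arbitrary coefficients
  serve linear independence; coefficients 1 describe the action on the sum of
  \<open>E\<close>.\<close>

lemma orthogonal_idempotents_sum:
  assumes "orthogonal_idempotents E" "f \<in> E"
  shows "circ f (\<Sum>e\<in>E. scale (a e) e) = scale (a f) f"
proof -
  have "circ f (\<Sum>e\<in>E. scale (a e) e) = (\<Sum>e\<in>E. if e = f then scale (a f) f else 0)"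
    unfolding circ_sum_right using assms
    by (intro sum.cong) (auto simp: orthogonal_idempotents_def circ_scale_right)
  then show ?thesis using assms by (simp add: orthogonal_idempotents_def)
qed

lemma orthogonal_idempotents_sum1:
  assumes "orthogonal_idempotents E" "f \<in> E"
  shows "circ f (\<Sum>E) = f"
  using orthogonal_idempotents_sum[OF assms, of "\<lambda>_. 1"] by simp

lemma orthogonal_idempotents_independent:
  assumes "orthogonal_idempotents E"
  shows "independent E"
proof (rule independent_if_scalars_zero)
  show "finite E" using assms by (simp add: orthogonal_idempotents_def)
  fix a f assume "(\<Sum>x\<in>E. scale (a x) x) = 0" "f \<in> E"
  then show "a f = 0"
    using orthogonal_idempotents_sum[OF assms, of f a] assms
    by (auto simp: orthogonal_idempotents_def circ_zero_right)
qed

lemma maximal_orthogonal_idempotents: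
  obtains E where "orthogonal_idempotents E"
    "\<And>F. orthogonal_idempotents F \<Longrightarrow> card F \<le> card E"
proof -
  have "card F \<le> dim UNIV" if "orthogonal_idempotents F" for F
    using independent_card_le_dim orthogonal_idempotents_independent that by blast
  moreover have "orthogonal_idempotents {}" by (simp add: orthogonal_idempotents_def)
  ultimately obtain E where "orthogonal_idempotents E \<and>
      (\<forall>F. orthogonal_idempotents F \<longrightarrow> card F \<le> card E)"
    using ex_has_greatest_nat[of orthogonal_idempotents "{}" card "Suc (dim UNIV)"]
    by (metis less_Suc_eq_le)
  then show thesis using that by blast
qed

text \<open>Since f = f (sum of \<open>E\<close>) for each member f, such an \<open>e\<close> is
  orthogonal to all of \<open>E\<close>; if nonzero, it could be added to \<open>E\<close>.\<close>

lemma maximal_annihilator_idempotent: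
  assumes E: "orthogonal_idempotents E"
    and max: "\<And>F. orthogonal_idempotents F \<Longrightarrow> card F \<le> card E"
    and e: "circ e e = e" "circ (\<Sum>E) e = 0"
  shows "e = 0"
proof (rule ccontr)
  assume "e \<noteq> 0"
  have *: "circ f e = 0" "circ e f = 0" if "f \<in> E" for f
    using orthogonal_idempotents_sum1[OF E that] e(2) circ_zero_right by (metis circ_ac)+
  have "e \<notin> E" using * e(1) \<open>e \<noteq> 0\<close> by metis
  moreover have "orthogonal_idempotents (insert e E)"
    using E * e(1) \<open>e \<noteq> 0\<close> \<open>e \<notin> E\<close> by (auto simp: orthogonal_idempotents_def)
  ultimately show False using max[of "insert e E"] E by (auto simp: orthogonal_idempotents_def)
qed

text \<open>Otherwise \<open>f\<close> could be replaced by the two orthogonal idempotents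
  \<open>e\<close> and \<open>f - e\<close>, giving a larger set.\<close>

lemma maximal_primitive:
  assumes E: "orthogonal_idempotents E"
    and max: "\<And>F. orthogonal_idempotents F \<Longrightarrow> card F \<le> card E"
    and f: "f \<in> E" and e: "circ e e = e" "circ f e = e"
  shows "e = 0 \<or> e = f"
proof (rule ccontr)
  assume ne: "\<not> (e = 0 \<or> e = f)"
  have orth: "circ g h = (if g = h then g else 0)" if "g \<in> E" "h \<in> E" for g h
    using E that by (auto simp: orthogonal_idempotents_def)
  define E' where "E' = E - {f}"
  have ef: "circ e f = e" using e(2) circ_commute by metis
  have ff: "circ f f = f" using orth f by simp
  have E'f: "circ g f = 0" "circ f g = 0" if "g \<in> E'" for g using that orth f by (auto simp: E'_def)
  have E'e: "circ g e = 0" "circ e g = 0" if "g \<in> E'" for g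
    using E'f[OF that] e(2) circ_zero_right circ_zero_left by (metis circ_ac)+
  \<comment> \<open>Multiplying by \<open>e\<close> or \<open>f\<close> shows that any of these
    coincidences would force e = 0 or e = f.\<close>
  have notin: "e \<notin> E'" "f - e \<notin> E'" "e \<noteq> f - e"
    using E'e E'f ne e ff ef
    by (metis, metis circ_diff_right diff_zero eq_iff_diff_eq_0,
        metis circ_diff_right eq_iff_diff_eq_0)
  have "orthogonal_idempotents (insert e (insert (f - e) E'))"
    using E orth E'e E'f ne e ff ef notin
    by (auto simp: orthogonal_idempotents_def E'_def circ_diff_left circ_diff_right)
  from max[OF this] have "Suc (Suc (card E')) \<le> card E"
    using notin E by (simp add: E'_def orthogonal_idempotents_def)
  then show False using f E card_Suc_Diff1[of E f] by (simp add: E'_def orthogonal_idempotents_def)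
qed

end

section \<open>Polynomials in an operator and existence of eigenvalues\<close>

definition poly_act ::
  "('a::field \<Rightarrow> 'b::ab_group_add \<Rightarrow> 'b) \<Rightarrow> ('b \<Rightarrow> 'b) \<Rightarrow> 'a poly \<Rightarrow> 'b \<Rightarrow> 'b" where
  "poly_act scale T p v = (\<Sum>i\<le>degree p. scale (coeff p i) ((T ^^ i) v))"

context vector_space
begin

text \<open>Coefficients beyond the degree vanish, so polynomials of different degrees can be summed
  over one common range.\<close>

lemma poly_act_upto:
  "degree p \<le> n \<Longrightarrow> poly_act scale T p v = (\<Sum>i\<le>n. scale (coeff p i) ((T ^^ i) v))"
  unfolding poly_act_def by (intro sum.mono_neutral_left) (auto simp: coeff_eq_0)

lemma poly_act_closed:
  assumes "subspace S" "\<And>x. x \<in> S \<Longrightarrow> T x \<in> S" "v \<in> S"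
  shows "poly_act scale T p v \<in> S"
proof -
  have "(T ^^ i) v \<in> S" for i using assms(2,3) by (induction i) auto
  then show ?thesis
    unfolding poly_act_def by (intro subspace_sum subspace_scale assms(1))
qed

lemma poly_act_linear_factor:
  assumes T: "module_hom scale scale T"
  shows "poly_act scale T ([:- c, 1:] * q) v = T (poly_act scale T q v) - scale c (poly_act scale T q v)"
proof -
  interpret T: module_hom scale scale T by (fact T)
  let ?p = "[:- c, 1:] * q" and ?n = "degree q"
  \<comment> \<open>Multiplication by the indeterminate is an index shift, which becomes one more
    application of \<open>T\<close>.\<close>
  have p: "?p = pCons 0 q - smult c q" by simp
  have "degree ?p \<le> Suc ?n"
    by (rule order.trans[OF degree_mult_le]) simp
  then have "poly_act scale T ?p v
      = (\<Sum>i\<le>Suc ?n. scale (coeff (pCons 0 q) i) ((T ^^ i) v))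
        - (\<Sum>i\<le>Suc ?n. scale c (scale (coeff q i) ((T ^^ i) v)))"
    unfolding p by (simp only: poly_act_upto sum_subtractf[symmetric])
      (simp only: coeff_diff coeff_smult scale_left_diff_distrib scale_scale)
  also have "(\<Sum>i\<le>Suc ?n. scale (coeff (pCons 0 q) i) ((T ^^ i) v)) = T (poly_act scale T q v)"
    unfolding sum.atMost_Suc_shift poly_act_def
    by (simp add: T.sum T.scale)
  also have "(\<Sum>i\<le>Suc ?n. scale c (scale (coeff q i) ((T ^^ i) v)))
      = scale c (poly_act scale T q v)"
    unfolding scale_sum_right[symmetric] by (simp only: poly_act_upto[of q "Suc ?n"] le_SucI order.refl)
  finally show ?thesis .
qed

end

text \<open>The first dim + 1 iterates of \<open>v\<close> are too many to be independent, and a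
  linear relation among them is the required polynomial.\<close>

lemma (in finite_dimensional_vector_space) annihilating_poly:
  obtains p where "p \<noteq> 0" "poly_act scale T p v = 0"
proof (cases "inj_on (\<lambda>i. (T ^^ i) v) {..dim UNIV}")
  case True
  define M where "M = (\<lambda>i. (T ^^ i) v) ` {..dim UNIV}"
  have "card M = Suc (dim UNIV)" using True by (simp add: M_def card_image)
  then have "dependent M" using independent_card_le_dim[of M UNIV] by fastforce
  moreover have "finite M" by (simp add: M_def)
  ultimately obtain u w where u: "w \<in> M" "u w \<noteq> 0" "(\<Sum>v\<in>M. scale (u v) v) = 0"
    using dependent_finite by blast
  define p where "p = (\<Sum>i\<le>dim UNIV. monom (u ((T ^^ i) v)) i)"
  have coeff: "coeff p i = (if i \<le> dim UNIV then u ((T ^^ i) v) else 0)" for i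
    by (simp add: p_def coeff_sum)
  have "degree p \<le> dim UNIV" by (rule degree_le) (simp add: coeff)
  then have "poly_act scale T p v = (\<Sum>i\<le>dim UNIV. scale (u ((T ^^ i) v)) ((T ^^ i) v))"
    by (simp add: poly_act_upto coeff)
  also have "\<dots> = (\<Sum>v\<in>M. scale (u v) v)"
    unfolding M_def sum.reindex[OF True] by simp
  finally have "poly_act scale T p v = 0" using u by simp
  moreover have "p \<noteq> 0"
  proof
    assume "p = 0"
    then have "u ((T ^^ i) v) = 0" if "i \<le> dim UNIV" for i using coeff[of i] that by simp
    then show False using u(1,2) by (auto simp: M_def)
  qed
  ultimately show ?thesis using that by blast
next
  case False
  \<comment> \<open>Dependence is a property of sets and does not see repeated iterates; here the
    difference of two monomials annihilates \<open>v\<close>.\<close>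
  then obtain i j where ij: "i \<noteq> j" "(T ^^ i) v = (T ^^ j) v" by (auto simp: inj_on_def)
  define p :: "'a poly" where "p = monom 1 i - monom 1 j"
  have "poly_act scale T p v = (\<Sum>k\<le>i + j. scale (coeff p k) ((T ^^ k) v))"
    by (rule poly_act_upto) (auto simp: p_def intro!: degree_diff_le degree_monom_le[THEN order.trans])
  also have "\<dots> = (\<Sum>k\<le>i + j. (if k = i then (T ^^ i) v else 0) - (if k = j then (T ^^ j) v else 0))"
    using ij by (intro sum.cong) (auto simp: p_def)
  also have "\<dots> = 0" using ij(2) by (simp add: sum_subtractf)
  finally have "poly_act scale T p v = 0" .
  moreover have "coeff p i = 1" using ij(1) by (simp add: p_def)
  then have "p \<noteq> 0" by auto
  ultimately show ?thesis using that by blast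
qed

text \<open>Split a linear factor with root c off a nonzero polynomial of least degree annihilating
  \<open>v\<close>. The cofactor sends \<open>v\<close> to a vector that is nonzero by minimality
  and that \<open>T\<close> scales by c.\<close>

lemma alg_closed_eigenvalue_exists:
  fixes scale :: "'a::alg_closed_field \<Rightarrow> 'b::ab_group_add \<Rightarrow> 'b"
  assumes "finite_dimensional_vector_space scale B" and T: "module_hom scale scale T"
    and S: "module.subspace scale S" "\<And>x. x \<in> S \<Longrightarrow> T x \<in> S" and v: "v \<in> S" "v \<noteq> 0"
  shows "\<exists>c. eigenvalue_on scale T S c"
proof -
  interpret finite_dimensional_vector_space scale B by (fact assms(1))
  let ?P = "\<lambda>p. p \<noteq> 0 \<and> poly_act scale T p v = 0"
  obtain p0 where "?P p0" using annihilating_poly by metis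
  then obtain p where p: "?P p" and min: "\<And>q. ?P q \<Longrightarrow> degree p \<le> degree q"
    using ex_has_least_nat[of ?P p0 degree] by blast
  have "degree p \<noteq> 0"
  proof
    assume "degree p = 0"
    then obtain a where "p = [:a:]" by (rule degree_eq_zeroE)
    then show False using p v by (simp add: poly_act_def)
  qed
  then obtain c where "poly p c = 0" using alg_closed_imp_poly_has_root by blast
  then obtain q where q: "p = [:- c, 1:] * q" by (auto simp: poly_eq_0_iff_dvd dvd_def)
  then have "q \<noteq> 0" using p by auto
  then have "degree q < degree p" unfolding q by (subst degree_mult_eq) auto
  define u where "u = poly_act scale T q v"
  have "u \<noteq> 0" using min[of q] \<open>q \<noteq> 0\<close> \<open>degree q < degree p\<close> by (auto simp: u_def)
  moreover have "u \<in> S" unfolding u_def by (rule poly_act_closed) (use S v in auto)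
  moreover have "T u = scale c u"
    using p poly_act_linear_factor[OF T, of c q v] unfolding q u_def by simp
  ultimately show ?thesis by (auto simp: eigenvalue_on_def)
qed

section \<open>Peirce components as ideals for both operations\<close>

context transposed_poisson_algebra
begin

lemma two_neq_0: "(2::'a) \<noteq> 0"
proof
  assume "(2::'a) = 0"
  then have "CHAR('a) dvd 2" using of_nat_eq_0_iff_char_dvd[where 'a = 'a, of 2] by simp
  then have "CHAR('a) = 1 \<or> CHAR('a) = 2" using two_is_prime_nat prime_nat_iff by blast
  then show False using char_neq_2 CHAR_not_1'[where 'a = 'a] by simp
qed

lemma module_homs:
  "module_hom scale scale (circ x)" "module_hom scale scale (bracket x)"
  "module_hom scale scale (\<lambda>x. bracket x y)"
  using linear_circ_right linear_bracket_right linear_bracket_left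
  by (simp_all add: linear_iff_module_hom)

lemma bracket_add_left: "bracket (x + y) z = bracket x z + bracket y z"
  using module_hom.add[OF module_homs(3)] .

lemma bracket_zero: "bracket 0 x = 0" "bracket x 0 = 0"
  using module_hom.zero[OF module_homs(3)] module_hom.zero[OF module_homs(2)] .

lemma scale_2: "scale 2 x = x + x"
  using scale_left_distrib[of 1 1 x] by simp

lemma scale_2_cancel: "scale 2 x = scale 2 y \<Longrightarrow> x = y"
  using two_neq_0 by (simp add: scale_cancel_left)

context
  fixes e
  assumes e: "circ e e = e"
begin

text \<open>With \<open>e\<close> as multiplier, the transposed Leibniz rule reads 2 e [x,y] =
  [e x, y] + [x, e y] = 2 [x,y], and 2 is invertible.\<close>

lemma idempotent_bracket_fixed:
  assumes "circ e x = x" "circ e y = y"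
  shows "circ e (bracket x y) = bracket x y"
  using transposed_leibniz[of e x y] assms
  by - (rule scale_2_cancel, simp add: scale_2)

lemma idempotent_bracket_annihilated:
  assumes "circ e x = 0" "circ e y = 0"
  shows "circ e (bracket x y) = 0"
  using transposed_leibniz[of e x y] assms
  by - (rule scale_2_cancel, simp add: scale_2 bracket_zero)

text \<open>
  By the transposed Leibniz rule the bracket would be an eigenvector of \<open>P\<^sub>e\<close> with
  eigenvalue \<open>1/2\<close>, but an idempotent only has the eigenvalues 0 and 1.
\<close>
lemma idempotent_bracket_mixed:
  assumes "circ e x = 0 \<and> circ e y = y \<or> circ e x = x \<and> circ e y = 0"
  shows "bracket x y = 0"
proof -
  let ?b = "bracket x y"
  have b: "circ e ?b + circ e ?b = ?b"
    using transposed_leibniz[of e x y] assms by (auto simp: scale_2 bracket_zero)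
  \<comment> \<open>Applying \<open>e\<close> to the fact \<open>b\<close> gives 2 e b = e b, so e b
    = 0, and \<open>b\<close> then makes the bracket itself vanish.\<close>
  have "circ e ?b + circ e ?b = circ e ?b"
    using arg_cong[OF b, of "circ e"] e circ_assoc[of e e ?b]
    by (simp add: module_hom.add[OF module_homs(1)])
  then show ?thesis using b by simp
qed

lemma peirce_split: "circ e (circ e x) = circ e x" "circ e (x - circ e x) = 0"
  using e circ_assoc[of e e x] by (simp_all add: module_hom.diff[OF module_homs(1)])

text \<open>For an arbitrary x, the part x - e x lies in the other component and brackets to zero
  with \<open>y\<close>; only e x contributes, and it lies in the same component as
  \<open>y\<close>.\<close>

lemma tp_ideal_fixed: "tp_ideal scale circ bracket {v. circ e v = v}"
proof -
  have "subspace {v. circ e v = v}"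
    by (auto simp: subspace_def module_hom.zero[OF module_homs(1)]
        module_hom.add[OF module_homs(1)] module_hom.scale[OF module_homs(1)])
  moreover have "circ e (circ x y) = circ x y" if "circ e y = y" for x y
    using that circ_assoc circ_commute by metis
  moreover have "circ e (bracket x y) = bracket x y" if "circ e y = y" for x y
  proof -
    have "bracket x y = bracket (circ e x) y + bracket (x - circ e x) y"
      using bracket_add_left[of "circ e x" "x - circ e x" y] by simp
    also have "bracket (x - circ e x) y = 0"
      using idempotent_bracket_mixed peirce_split that by blast
    finally show ?thesis using idempotent_bracket_fixed[OF peirce_split(1) that, of x] by simp
  qed
  ultimately show ?thesis by (auto simp: tp_ideal_def)
qed

text \<open>Here the roles are exchanged: e x brackets to zero with \<open>y\<close> and only x - e
  x contributes.\<close>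

lemma tp_ideal_annihilator: "tp_ideal scale circ bracket {v. circ e v = 0}"
proof -
  have "subspace {v. circ e v = 0}"
    by (auto simp: subspace_def module_hom.zero[OF module_homs(1)]
        module_hom.add[OF module_homs(1)] module_hom.scale[OF module_homs(1)])
  moreover have "circ e (circ x y) = 0" if "circ e y = 0" for x y
    using that circ_assoc circ_commute module_hom.zero[OF module_homs(1)] by metis
  moreover have "circ e (bracket x y) = 0" if "circ e y = 0" for x y
  proof -
    have "bracket x y = bracket (circ e x) y + bracket (x - circ e x) y"
      using bracket_add_left[of "circ e x" "x - circ e x" y] by simp
    also have "bracket (circ e x) y = 0"
      using idempotent_bracket_mixed peirce_split that by blast
    finally show ?thesis
      using idempotent_bracket_annihilated[OF peirce_split(2) that, of x] by simp
  qed
  ultimately show ?thesis by (auto simp: tp_ideal_def)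
qed

end

end

section \<open>Assembly of the decomposition\<close>

theorem theorem2p8:
  fixes scale :: "'a::alg_closed_field \<Rightarrow> 'b::ab_group_add \<Rightarrow> 'b"
    and circ bracket :: "'b \<Rightarrow> 'b \<Rightarrow> 'b"
  assumes "transposed_poisson_algebra scale circ bracket"
    and "\<exists>B. finite_dimensional_vector_space scale B"
  shows "\<exists>D N. tp_ideal scale circ bracket D \<and> tp_ideal scale circ bracket N \<and>
           direct_sum2 UNIV D N \<and>
           unital_on circ D \<and>
           nilpotent_on scale circ N \<and>
           (\<exists>(\<Delta> :: nat set) Di.
              direct_sum_family scale D \<Delta> Di \<and>
              (\<forall>i\<in>\<Delta>. tp_ideal scale circ bracket (Di i) \<and>
                 (\<forall>x\<in>Di i. \<exists>!c. eigenvalue_on scale (circ x) (Di i) c)))"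
proof -
  interpret tp: transposed_poisson_algebra scale circ bracket by (fact assms(1))
  obtain B where B: "finite_dimensional_vector_space scale B" using assms(2) by blast
  interpret fin_dim_comm_algebra scale B circ
    using B tp.linear_circ_right tp.circ_assoc tp.circ_commute
    by (simp add: fin_dim_comm_algebra_def fin_dim_comm_algebra_axioms_def)
  obtain E where E: "orthogonal_idempotents E"
    and max: "\<And>F. orthogonal_idempotents F \<Longrightarrow> card F \<le> card E"
    using maximal_orthogonal_idempotents by blast
  define e where "e = \<Sum>E"
  have orth: "circ f g = (if f = g then f else 0)" if "f \<in> E" "g \<in> E" for f g
    using E that by (auto simp: orthogonal_idempotents_def)
  have "finite E" "0 \<notin> E" using E by (auto simp: orthogonal_idempotents_def)
  have fe: "circ f e = f" "circ e f = f" if "f \<in> E" for f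
    using orthogonal_idempotents_sum1[OF E that] circ_commute by (simp_all add: e_def)
  have ee: "circ e e = e"
    using fe by (subst (2) e_def, subst circ_sum_right) (simp add: e_def)
  define D where "D = {v. circ e v = v}"
  define N where "N = {v. circ e v = 0}"
  define Di where "Di f = {v. circ f v = v}" for f
  have DN: "tp_ideal scale circ bracket D" "tp_ideal scale circ bracket N"
    using tp.tp_ideal_fixed tp.tp_ideal_annihilator ee by (auto simp: D_def N_def)
  have sum: "direct_sum2 UNIV D N"
  proof -
    have "\<exists>a b. x = a + b \<and> a \<in> D \<and> b \<in> N" for x
      using tp.peirce_split[OF ee, of x]
      by (intro exI[of _ "circ e x"] exI[of _ "x - circ e x"]) (auto simp: D_def N_def)
    moreover have "D \<inter> N = {0}" by (auto simp: D_def N_def circ_zero_right)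
    ultimately show ?thesis unfolding direct_sum2_def by blast
  qed
  have unital: "unital_on circ D"
    unfolding unital_on_def using ee by (intro bexI[of _ e]) (auto simp: D_def circ_commute)
  have nilp: "nilpotent_on scale circ N"
    unfolding N_def
  proof (rule no_idempotent_imp_nilpotent_on)
    show "tp.subspace {v. circ e v = 0}" by (rule subspace_annihilator)
    show "circ y z \<in> {v. circ e v = 0}" if "y \<in> {v. circ e v = 0}" for y z
      using that circ_assoc[of e y z] by (simp add: circ_zero_left)
    show "f = 0" if "f \<in> {v. circ e v = 0}" "circ f f = f" for f
      using maximal_annihilator_idempotent[OF E max] that by (simp add: e_def)
  qed
  \<comment> \<open>The summands must be indexed by natural numbers, so \<open>E\<close> is
    enumerated. If \<open>E\<close> is empty, then e = 0, the index set is empty and D = 0.\<close>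
  obtain h where h: "bij_betw h {0..<card E} E"
    using ex_bij_betw_nat_finite[OF \<open>finite E\<close>] by blast
  have hE: "h i \<in> E" if "i \<in> {0..<card E}" for i using h that by (auto simp: bij_betw_def)
  have family: "direct_sum_family scale D {0..<card E} (\<lambda>i. Di (h i))"
    unfolding direct_sum_family_def
  proof (intro conjI ballI)
    have D: "(\<Union>i\<in>{0..<card E}. Di (h i)) = (\<Union>f\<in>E. Di f)"
      using arg_cong[OF bij_betw_imp_surj_on[OF h], of "\<lambda>F. \<Union>f\<in>F. Di f"]
      by (simp only: image_image)
    show "D = tp.span (\<Union>i\<in>{0..<card E}. Di (h i))"
      unfolding D
    proof (rule antisym)
      show "tp.span (\<Union>f\<in>E. Di f) \<subseteq> D"
        unfolding D_def
      proof (rule tp.span_minimal[OF _ subspace_fixed], safe)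
        fix f v assume "f \<in> E" "v \<in> Di f"
        then show "circ e v = v" using fe(2) circ_assoc[of e f v] by (simp add: Di_def)
      qed
      show "D \<subseteq> tp.span (\<Union>f\<in>E. Di f)"
      proof
        fix x assume "x \<in> D"
        \<comment> \<open>The components of x = e x are read off from e being the sum of
          \<open>E\<close>.\<close>
        then have "(\<Sum>f\<in>E. circ f x) = x"
          unfolding D_def e_def circ_sum_left by simp
        moreover have "circ f x \<in> Di f" if "f \<in> E" for f
          using orth[OF that that] circ_assoc[of f f x] by (simp add: Di_def)
        then have "(\<Sum>f\<in>E. circ f x) \<in> tp.span (\<Union>f\<in>E. Di f)"
          by (blast intro: tp.span_sum tp.span_base)
        ultimately show "x \<in> tp.span (\<Union>f\<in>E. Di f)" by simp
      qed
    qed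
    fix i assume i: "i \<in> {0..<card E}"
    \<comment> \<open>The idempotent \<open>h i\<close> kills all other summands but fixes its own
      pointwise, so the intersection is zero.\<close>
    have "tp.span (\<Union>j\<in>{0..<card E} - {i}. Di (h j)) \<subseteq> {v. circ (h i) v = 0}"
    proof (rule tp.span_minimal[OF _ subspace_annihilator], safe)
      fix j v assume j: "j \<in> {0..<card E}" "v \<in> Di (h j)" "j \<noteq> i"
      then have "h i \<noteq> h j" using h i by (metis bij_betw_def inj_on_def)
      then have "circ (h i) (h j) = 0" using orth hE i j by simp
      then show "circ (h i) v = 0"
        using j(2) circ_assoc[of "h i" "h j" v] by (simp add: Di_def circ_zero_left)
    qed
    then show "Di (h i) \<inter> tp.span (\<Union>j\<in>{0..<card E} - {i}. Di (h j)) = {0}"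
      by (auto simp: Di_def tp.span_zero circ_zero_right)
  qed
  have ideal: "tp_ideal scale circ bracket (Di f)" if "f \<in> E" for f
    unfolding Di_def using tp.tp_ideal_fixed orth that by simp
  have eigen: "\<exists>!c. eigenvalue_on scale (circ x) (Di f) c" if f: "f \<in> E" and x: "x \<in> Di f" for f x
  proof (rule ex_ex1I)
    \<comment> \<open>The idempotent \<open>f\<close> itself is the nonzero vector from which an
      eigenvector is constructed.\<close>
    have "f \<in> Di f" "f \<noteq> 0" using f orth \<open>0 \<notin> E\<close> by (auto simp: Di_def)
    moreover have "tp.subspace (Di f)" unfolding Di_def by (rule subspace_fixed)
    moreover have "circ x y \<in> Di f" for y
      using x fixed_imp_closed by (auto simp: Di_def)
    ultimately show "\<exists>c. eigenvalue_on scale (circ x) (Di f) c"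
      using alg_closed_eigenvalue_exists[OF B module_hom_circ] by blast
    fix c d
    assume "eigenvalue_on scale (circ x) (Di f) c" "eigenvalue_on scale (circ x) (Di f) d"
    then show "c = d"
      using primitive_idempotent_unique_eigenvalue[of f x] maximal_primitive[OF E max f] orth f x
      unfolding Di_def by simp
  qed
  have "\<forall>i\<in>{0..<card E}. tp_ideal scale circ bracket (Di (h i)) \<and>
      (\<forall>x\<in>Di (h i). \<exists>!c. eigenvalue_on scale (circ x) (Di (h i)) c)"
    using ideal eigen hE by blast
  then show ?thesis using DN sum unital nilp family by blast
qed

end
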